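(* Let $1\le M<N$ and let $\mathbf{X}=\mathbf{S}+\mathbf{N}$, where $\mathbf{S}$ and $\mathbf{N}$ are independent $\mathbb{R}^N$-valued random vectors, $\mathbf{S}$ has finite second moments and covariance matrix $C_{\mathbf S}$ of rank at most $M$, and $\mathbf{N}$ is zero-mean Gaussian with covariance matrix $\sigma_{\mathbf N}^2 I$, $\sigma_{\mathbf N}^2>0$. Let $\mathbf{Y}_M$ consist of the first $M$ components of $\mathbf{Y}=W^T\mathbf{X}$, where $W$ is an orthogonal matrix whose columns are eigenvectors of the covariance matrix of $\mathbf{X}$ ordered by decreasing eigenvalue (PCA). Then the relevant information loss vanishes: $$L_{\mathbf S}(\mathbf{X}\to\mathbf{Y}_M)=0.$$
   Context: Relevant information loss: for a random variable $\mathbf{X}$, a (measurable) function $\mathbf{Y}'=g(\mathbf{X})$ and a relevant random variable $\mathbf{S}$, $L_{\mathbf S}(\mathbf{X}\to\mathbf{Y}')=\sup_{\mathcal P}\big(I(\hat{\mathbf S};\mathbf X)-I(\hat{\mathbf S};\mathbf Y')\big)=I(\mathbf{X};\mathbf{S}|\mathbf{Y}')$, the supremum being over finite measurable partitions $\mathcal P$ of the sample space of $\mathbf S$ and $\hat{\mathbf S}$ being $\mathbf S$ quantized according to $\mathcal P$. *)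

theory Defs
  imports "HOL-Probability.Probability"
begin

definition covariance_matrix :: "'a measure \<Rightarrow> ('a \<Rightarrow> real^'n) \<Rightarrow> real^'n^'n" where
  "covariance_matrix M X =
     (\<chi> i j. \<integral>\<omega>. (X \<omega> $ i - (\<integral>\<nu>. X \<nu> $ i \<partial>M)) * (X \<omega> $ j - (\<integral>\<nu>. X \<nu> $ j \<partial>M)) \<partial>M)"

(* Only meaningful for positive definite C; degenerate Gaussians have no Lebesgue density. *)
definition gaussian_density :: "real^'n \<Rightarrow> real^'n^'n \<Rightarrow> real^'n \<Rightarrow> real" where
  "gaussian_density \<mu> C x =
     exp (- ((x - \<mu>) \<bullet> (matrix_inv C *v (x - \<mu>))) / 2) / sqrt ((2 * pi) ^ CARD('n) * det C)"

definition gaussian_vector :: "'a measure \<Rightarrow> ('a \<Rightarrow> real^'n) \<Rightarrow> real^'n \<Rightarrow> real^'n^'n \<Rightarrow> bool" where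
  "gaussian_vector M X \<mu> C \<longleftrightarrow> distributed M lborel X (\<lambda>x. ennreal (gaussian_density \<mu> C x))"

(* Eigenvalues decrease along the linear order of the index type. *)
definition pca_matrix ::
    "real^('n::{finite,linorder})^('n::{finite,linorder}) \<Rightarrow>
     real^('n::{finite,linorder})^('n::{finite,linorder}) \<Rightarrow> bool" where
  "pca_matrix C W \<longleftrightarrow> orthogonal_matrix W \<and>
     (\<exists>ev :: 'n \<Rightarrow> real. antimono ev \<and> (\<forall>i. C *v column i W = ev i *\<^sub>R column i W))"

(* The components of y at the CARD('m) smallest indices, in increasing order: component i of the
   result is the component of y whose index has as many predecessors in 'n as i has in 'm.
   Only meaningful for CARD('m) \<le> CARD('n). *)
definition first_components ::
    "real^('n::{finite,linorder}) \<Rightarrow> real^('m::{finite,linorder})" where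
  "first_components y = (\<chi> i. y $ (sorted_list_of_set (UNIV :: 'n set) ! card {..<i}))"

definition quantize :: "'s set set \<Rightarrow> 's \<Rightarrow> 's set" where
  "quantize P s = (THE A. A \<in> P \<and> s \<in> A)"

(* Supremum over the finite measurable partitions P of the sample space of S. The quantization of S
   takes finitely many values, so both mutual informations are finite and their difference makes
   sense in the reals; the supremum itself may be infinite. *)
definition relevant_information_loss ::
    "'a measure \<Rightarrow> real \<Rightarrow> 's measure \<Rightarrow> 'x measure \<Rightarrow> 'y measure \<Rightarrow>
     ('a \<Rightarrow> 's) \<Rightarrow> ('a \<Rightarrow> 'x) \<Rightarrow> ('a \<Rightarrow> 'y) \<Rightarrow> ereal" where
  "relevant_information_loss M b A B C S X Y =
     (SUP P \<in> {P. finite P \<and> partition_on (space A) P \<and> P \<subseteq> sets A}.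
        ereal (prob_space.mutual_information M b (count_space P) B (\<lambda>\<omega>. quantize P (S \<omega>)) X
             - prob_space.mutual_information M b (count_space P) C (\<lambda>\<omega>. quantize P (S \<omega>)) Y))"

end

theory Submission
  imports Defs
begin

text \<open>The noise covariance is a multiple \<open>\<tau>\<close> of the identity, so the principal axes \<open>w\<^sub>k\<close> of \<open>X\<close> are
  eigenvectors of the covariance matrix of \<open>S\<close>. By the rank bound the eigenvalues of the latter beyond
  the first \<open>m\<close> vanish, hence \<open>w\<^sub>k \<bullet> S\<close> is almost surely constant for these \<open>k\<close>. Expanding
  \<open>\<parallel>x - s\<parallel>\<^sup>2\<close> in the principal axes, the likelihood of \<open>x\<close> given \<open>s\<close> is therefore a factor free of \<open>s\<close>
  times a function of \<open>s\<close> and the first \<open>m\<close> components of \<open>W\<^sup>T x\<close>. So the posterior of every quantization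
  of \<open>S\<close> depends on \<open>X\<close> through \<open>Y\<^sub>M\<close> only, the density of the joint law with respect to the product
  of the marginals factors through \<open>Y\<^sub>M\<close>, and the two mutual informations are the same integral.\<close>

section \<open>Mutual information and sufficient statistics\<close>

text \<open>Applying \<open>T\<close> to the second coordinate carries the joint law and the product
  of the marginals of \<open>(D, X)\<close> to those of \<open>(D, T X)\<close>, and the density
  \<open>f\<close> survives. Both informations are then the integral of \<open>f * log b f\<close>,
  related by a change of variables. For Bochner integrals this holds also in the non-integrable
  case, where both sides are 0.\<close>

lemma (in information_space) mutual_information_eq_if_density_factors:
  assumes D [measurable]: "D \<in> M \<rightarrow>\<^sub>M K"
    and X [measurable]: "X \<in> M \<rightarrow>\<^sub>M B"
    and T [measurable]: "T \<in> B \<rightarrow>\<^sub>M C"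
    and f [measurable]: "f \<in> borel_measurable (K \<Otimes>\<^sub>M C)"
    and f_nonneg: "\<And>z. 0 \<le> (f z :: real)"
    and joint: "distr M (K \<Otimes>\<^sub>M B) (\<lambda>\<omega>. (D \<omega>, X \<omega>)) =
      density (distr M K D \<Otimes>\<^sub>M distr M B X) (\<lambda>z. ennreal (f (fst z, T (snd z))))"
  shows "mutual_information b K B D X = mutual_information b K C D (\<lambda>\<omega>. T (X \<omega>))"
proof -
  let ?h = "\<lambda>z. (fst z, T (snd z))"
  let ?P = "distr M K D \<Otimes>\<^sub>M distr M B X"
  let ?R = "distr M K D \<Otimes>\<^sub>M distr M C (\<lambda>\<omega>. T (X \<omega>))"
  interpret PD: prob_space "distr M K D" by (rule prob_space_distr) fact
  interpret PX: prob_space "distr M B X" by (rule prob_space_distr) fact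
  interpret PY: prob_space "distr M C (\<lambda>\<omega>. T (X \<omega>))" by (rule prob_space_distr) measurable
  interpret DX: pair_prob_space "distr M K D" "distr M B X" ..
  interpret DY: pair_prob_space "distr M K D" "distr M C (\<lambda>\<omega>. T (X \<omega>))" ..
  have f' [measurable]: "f \<in> borel_measurable ?R"
    by (simp cong: measurable_cong_sets)
  have h [measurable]: "?h \<in> ?P \<rightarrow>\<^sub>M K \<Otimes>\<^sub>M C"
    by (simp cong: measurable_cong_sets)
  \<comment> \<open>A product of image measures is the image of the product measure; the identity
    serves as the map on the first factor.\<close>
  have "distr M K D \<Otimes>\<^sub>M distr (distr M B X) C T = distr ?P (K \<Otimes>\<^sub>M C) ?h"
    using pair_measure_distr[of "\<lambda>x. x" "distr M K D" K T "distr M B X" C]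
      PY.sigma_finite_measure_axioms
    by (simp add: distr_distr comp_def case_prod_beta' distr_id2)
  then have R: "?R = distr ?P (K \<Otimes>\<^sub>M C) ?h"
    by (simp add: distr_distr comp_def)
  have "distr M (K \<Otimes>\<^sub>M C) (\<lambda>\<omega>. (D \<omega>, T (X \<omega>))) =
      distr (distr M (K \<Otimes>\<^sub>M B) (\<lambda>\<omega>. (D \<omega>, X \<omega>))) (K \<Otimes>\<^sub>M C) ?h"
    by (subst distr_distr) (auto simp: comp_def)
  also have "\<dots> = density ?R f"
    unfolding joint R by (subst density_distr) simp_all
  finally have Y: "distr M (K \<Otimes>\<^sub>M C) (\<lambda>\<omega>. (D \<omega>, T (X \<omega>))) = density ?R f" .
  have "mutual_information b K B D X = (\<integral>z. f (?h z) * log b (f (?h z)) \<partial>?P)"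
    unfolding mutual_information_def joint
    by (rule DX.KL_density) (use b_gt_1 f_nonneg in auto)
  also have "\<dots> = (\<integral>z. f z * log b (f z) \<partial>?R)"
    unfolding R by (subst integral_distr) simp_all
  also have "\<dots> = mutual_information b K C D (\<lambda>\<omega>. T (X \<omega>))"
    unfolding mutual_information_def Y
    by (rule DY.KL_density[symmetric]) (use b_gt_1 f_nonneg in auto)
  finally show ?thesis .
qed

text \<open>The hypothesis \<open>posterior\<close> says that \<open>\<rho> p (T X)\<close> is a
  version of the conditional probability of \<open>D = p\<close> given \<open>X\<close>. By Bayes,
  posterior over prior is the density of the joint law with respect to the product of the marginals,
  and here it sees \<open>X\<close> only through \<open>T\<close>.\<close>

lemma (in information_space) mutual_information_eq_if_posterior_factors:
  fixes \<rho> :: "'k \<Rightarrow> 'c \<Rightarrow> real"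
  assumes P: "finite P"
    and D [measurable]: "D \<in> M \<rightarrow>\<^sub>M count_space P"
    and X [measurable]: "X \<in> M \<rightarrow>\<^sub>M B"
    and T [measurable]: "T \<in> B \<rightarrow>\<^sub>M C"
    and \<rho> [measurable]: "\<And>p. p \<in> P \<Longrightarrow> \<rho> p \<in> borel_measurable C"
    and \<rho>_nonneg: "\<And>p y. 0 \<le> \<rho> p y"
    and posterior: "\<And>p A. p \<in> P \<Longrightarrow> A \<in> sets B \<Longrightarrow>
      emeasure M {\<omega> \<in> space M. D \<omega> = p \<and> X \<omega> \<in> A} =
      (\<integral>\<^sup>+\<omega>. indicator A (X \<omega>) * ennreal (\<rho> p (T (X \<omega>))) \<partial>M)"
  shows "mutual_information b (count_space P) B D X =
    mutual_information b (count_space P) C D (\<lambda>\<omega>. T (X \<omega>))"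
proof -
  let ?K = "count_space P"
  define pr where "pr p = prob {\<omega> \<in> space M. D \<omega> = p}" for p
  define f where "f = (\<lambda>(p, y). \<rho> p y / pr p)"
  let ?g = "\<lambda>z. ennreal (f (fst z, T (snd z)))"
  let ?Q = "distr M ?K D \<Otimes>\<^sub>M distr M B X"
  interpret PX: prob_space "distr M B X" by (rule prob_space_distr) fact
  have f [measurable]: "f \<in> borel_measurable (?K \<Otimes>\<^sub>M C)"
    unfolding f_def
    by (rule measurable_pair_measure_countable1) (auto simp: P countable_finite)
  have f_nonneg: "0 \<le> f z" for z
    by (auto simp: f_def pr_def \<rho>_nonneg split: prod.split)
  have sets_Q: "sets ?Q = sets (?K \<Otimes>\<^sub>M B)"
    by (rule sets_pair_measure_cong) simp_all
  have gQ [measurable]: "?g \<in> borel_measurable ?Q"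
    by (simp cong: measurable_cong_sets)
  have joint: "distr M (?K \<Otimes>\<^sub>M B) (\<lambda>\<omega>. (D \<omega>, X \<omega>)) = density ?Q ?g"
  proof (rule measure_eqI)
    show "sets (distr M (?K \<Otimes>\<^sub>M B) (\<lambda>\<omega>. (D \<omega>, X \<omega>))) = sets (density ?Q ?g)"
      by (simp add: sets_Q)
  next
    fix A assume "A \<in> sets (distr M (?K \<Otimes>\<^sub>M B) (\<lambda>\<omega>. (D \<omega>, X \<omega>)))"
    then have A [measurable]: "A \<in> sets (?K \<Otimes>\<^sub>M B)" by simp
    have AQ [measurable]: "A \<in> sets ?Q" using A by (simp add: sets_Q)
    have Ap [measurable]: "Pair p -` A \<in> sets B" if "p \<in> P" for p
      using A by (rule sets_Pair1)
    have D_in: "D \<omega> \<in> P" if "\<omega> \<in> space M" for \<omega>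
      using measurable_space[OF D that] by simp
    have slice: "(\<integral>\<^sup>+\<omega>. F (D \<omega>) \<partial>M) =
        (\<Sum>p\<in>P. F p * emeasure M {\<omega> \<in> space M. D \<omega> = p})" for F :: "'k \<Rightarrow> ennreal"
    proof -
      have "(\<integral>\<^sup>+\<omega>. F (D \<omega>) \<partial>M) =
          (\<integral>\<^sup>+\<omega>. (\<Sum>p\<in>P. F p * indicator {\<omega> \<in> space M. D \<omega> = p} \<omega>) \<partial>M)"
        using D_in P by (intro nn_integral_cong) (simp add: indicator_def if_distrib sum.delta' cong: if_cong)
      also have "\<dots> = (\<Sum>p\<in>P. F p * emeasure M {\<omega> \<in> space M. D \<omega> = p})"
        by (subst nn_integral_sum) (auto intro!: sum.cong nn_integral_cmult_indicator)
      finally show ?thesis .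
    qed
    have piece: "emeasure M {\<omega> \<in> space M. D \<omega> = p \<and> X \<omega> \<in> Pair p -` A} =
        (\<integral>\<^sup>+x. indicator A (p, x) * ?g (p, x) \<partial>distr M B X) *
          emeasure M {\<omega> \<in> space M. D \<omega> = p}" if p: "p \<in> P" for p
    proof (cases "pr p = 0")
      \<comment> \<open>Here \<open>f\<close> has the default value 0 of a division by 0, which is
        harmless because the event \<open>D \<omega> = p\<close> is null.\<close>
      case True
      then have 0: "emeasure M {\<omega> \<in> space M. D \<omega> = p} = 0"
        by (simp add: pr_def emeasure_eq_measure)
      have "emeasure M {\<omega> \<in> space M. D \<omega> = p \<and> X \<omega> \<in> Pair p -` A} \<le>
          emeasure M {\<omega> \<in> space M. D \<omega> = p}"
        using p by (intro emeasure_mono) auto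
      with 0 show ?thesis by simp
    next
      case False
      then have pr: "pr p > 0" by (simp add: pr_def less_le)
      have [measurable]: "p \<in> space ?K" using p by simp
      have "emeasure M {\<omega> \<in> space M. D \<omega> = p \<and> X \<omega> \<in> Pair p -` A} =
          (\<integral>\<^sup>+\<omega>. indicator (Pair p -` A) (X \<omega>) * ennreal (\<rho> p (T (X \<omega>))) \<partial>M)"
        by (rule posterior) (use p Ap in auto)
      also have "\<dots> = (\<integral>\<^sup>+\<omega>. (indicator A (p, X \<omega>) * ?g (p, X \<omega>)) * ennreal (pr p) \<partial>M)"
        using pr \<rho>_nonneg
        by (intro nn_integral_cong) (simp add: f_def indicator_def flip: ennreal_mult)
      also have "\<dots> = (\<integral>\<^sup>+\<omega>. indicator A (p, X \<omega>) * ?g (p, X \<omega>) \<partial>M) * ennreal (pr p)"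
        by (rule nn_integral_multc) measurable
      also have "\<dots> = (\<integral>\<^sup>+x. indicator A (p, x) * ?g (p, x) \<partial>distr M B X) * ennreal (pr p)"
        by (subst nn_integral_distr) simp_all
      finally show ?thesis by (simp add: pr_def emeasure_eq_measure)
    qed
    have "emeasure (distr M (?K \<Otimes>\<^sub>M B) (\<lambda>\<omega>. (D \<omega>, X \<omega>))) A =
        emeasure M (\<Union>p\<in>P. {\<omega> \<in> space M. D \<omega> = p \<and> X \<omega> \<in> Pair p -` A})"
      using D_in by (subst emeasure_distr) (auto intro!: arg_cong[where f = "emeasure M"])
    also have "\<dots> = (\<Sum>p\<in>P. emeasure M {\<omega> \<in> space M. D \<omega> = p \<and> X \<omega> \<in> Pair p -` A})"
      by (rule sum_emeasure[symmetric]) (auto simp: P disjoint_family_on_def)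
    also have "\<dots> = (\<integral>\<^sup>+\<omega>. (\<integral>\<^sup>+x. indicator A (D \<omega>, x) * ?g (D \<omega>, x) \<partial>distr M B X) \<partial>M)"
      by (subst slice[of "\<lambda>p. \<integral>\<^sup>+x. indicator A (p, x) * ?g (p, x) \<partial>distr M B X"])
        (rule sum.cong[OF refl piece])
    also have "\<dots> = (\<integral>\<^sup>+p. (\<integral>\<^sup>+x. indicator A (p, x) * ?g (p, x) \<partial>distr M B X) \<partial>distr M ?K D)"
      by (subst nn_integral_distr) auto
    also have "\<dots> = (\<integral>\<^sup>+z. indicator A z * ?g z \<partial>?Q)"
      by (subst PX.nn_integral_fst[symmetric]) (auto simp: case_prod_beta')
    also have "\<dots> = emeasure (density ?Q ?g) A"
      by (simp add: emeasure_density mult.commute)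
    finally show "emeasure (distr M (?K \<Otimes>\<^sub>M B) (\<lambda>\<omega>. (D \<omega>, X \<omega>))) A = emeasure (density ?Q ?g) A" .
  qed
  show ?thesis
    by (rule mutual_information_eq_if_density_factors[OF D X T f f_nonneg joint])
qed

section \<open>A signal in additive noise\<close>

text \<open>Independence makes the law of \<open>(S, N)\<close> a product, and for fixed
  \<open>s\<close> translation invariance of Lebesgue measure turns the noise variable into
  \<open>x = s + n\<close>. Tonelli then moves \<open>x\<close> outside, so that the inner integral
  is the density of \<open>X\<close> on the event that \<open>S\<close> lies in
  \<open>G\<close>.\<close>

lemma (in prob_space) emeasure_joint_additive_noise:
  fixes S N X :: "'a \<Rightarrow> 'e::euclidean_space"
  assumes indep: "indep_var borel S borel N"
    and N: "distributed M lborel N g"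
    and X: "\<And>\<omega>. \<omega> \<in> space M \<Longrightarrow> X \<omega> = S \<omega> + N \<omega>"
    and G [measurable]: "G \<in> sets borel" and A [measurable]: "A \<in> sets borel"
  shows "emeasure M {\<omega> \<in> space M. S \<omega> \<in> G \<and> X \<omega> \<in> A} =
    (\<integral>\<^sup>+x. indicator A x * (\<integral>\<^sup>+s. indicator G s * g (x - s) \<partial>distr M borel S) \<partial>lborel)"
proof -
  have S [measurable]: "S \<in> borel_measurable M" and N' [measurable]: "N \<in> borel_measurable M"
    using indep_var_rv1[OF indep] indep_var_rv2[OF indep] .
  have g [measurable]: "g \<in> borel_measurable borel"
    using distributed_borel_measurable[OF N] by simp
  have N_law: "distr M borel N = density lborel g"
    using distributed_distr_eq_density[OF N] by (simp cong: distr_cong)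
  interpret PS: prob_space "distr M borel S" by (rule prob_space_distr) fact
  interpret PN: prob_space "distr M borel N" by (rule prob_space_distr) fact
  interpret SL: pair_sigma_finite "distr M borel S" "lborel :: 'e measure" ..
  let ?F = "\<lambda>z. indicator G (fst z) * indicator A (fst z + snd z) :: ennreal"
  have "emeasure M {\<omega> \<in> space M. S \<omega> \<in> G \<and> X \<omega> \<in> A} =
      (\<integral>\<^sup>+\<omega>. indicator {\<omega> \<in> space M. S \<omega> \<in> G \<and> S \<omega> + N \<omega> \<in> A} \<omega> \<partial>M)"
    by (subst nn_integral_indicator) (auto simp: X intro!: arg_cong[where f = "emeasure M"])
  also have "\<dots> = (\<integral>\<^sup>+\<omega>. ?F (S \<omega>, N \<omega>) \<partial>M)"
    by (intro nn_integral_cong) (simp add: indicator_def)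
  also have "\<dots> = (\<integral>\<^sup>+z. ?F z \<partial>distr M (borel \<Otimes>\<^sub>M borel) (\<lambda>\<omega>. (S \<omega>, N \<omega>)))"
    by (subst nn_integral_distr) simp_all
  also have "\<dots> = (\<integral>\<^sup>+z. ?F z \<partial>(distr M borel S \<Otimes>\<^sub>M distr M borel N))"
    using indep by (simp add: indep_var_distribution_eq)
  also have "\<dots> = (\<integral>\<^sup>+s. (\<integral>\<^sup>+n. ?F (s, n) \<partial>distr M borel N) \<partial>distr M borel S)"
    by (rule PN.nn_integral_fst[symmetric]) (simp cong: measurable_cong_sets)
  also have "\<dots> = (\<integral>\<^sup>+s. (\<integral>\<^sup>+x. indicator A x * (indicator G s * g (x - s)) \<partial>lborel) \<partial>distr M borel S)"
  proof (rule nn_integral_cong)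
    fix s
    have "(\<integral>\<^sup>+n. ?F (s, n) \<partial>distr M borel N) =
        (\<integral>\<^sup>+n. indicator A (s + n) * (indicator G s * g ((s + n) - s)) \<partial>lborel)"
      unfolding N_law by (subst nn_integral_density) (auto simp: mult_ac)
    also have "\<dots> = (\<integral>\<^sup>+x. indicator A x * (indicator G s * g (x - s)) \<partial>distr lborel borel ((+) s))"
      by (subst nn_integral_distr) simp_all
    also have "\<dots> = (\<integral>\<^sup>+x. indicator A x * (indicator G s * g (x - s)) \<partial>lborel)"
      unfolding lborel_distr_plus ..
    finally show "(\<integral>\<^sup>+n. ?F (s, n) \<partial>distr M borel N) =
        (\<integral>\<^sup>+x. indicator A x * (indicator G s * g (x - s)) \<partial>lborel)" .
  qed
  also have "\<dots> = (\<integral>\<^sup>+x. (\<integral>\<^sup>+s. indicator A x * (indicator G s * g (x - s)) \<partial>distr M borel S) \<partial>lborel)"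
    by (rule SL.Fubini'[symmetric]) (simp cong: measurable_cong_sets)
  also have "\<dots> = (\<integral>\<^sup>+x. indicator A x * (\<integral>\<^sup>+s. indicator G s * g (x - s) \<partial>distr M borel S) \<partial>lborel)"
    by (intro nn_integral_cong nn_integral_cmult) simp
  finally show ?thesis .
qed

text \<open>The hypothesis on \<open>g\<close> is the Fisher--Neyman factorization of the likelihood \<open>x \<mapsto> g (x - s)\<close>,
  which makes \<open>T\<close> sufficient for the signal.\<close>

lemma (in information_space) mutual_information_additive_noise_sufficient:
  fixes S N X :: "'a \<Rightarrow> 'e::euclidean_space" and g :: "'e \<Rightarrow> ennreal"
  assumes indep: "indep_var borel S borel N"
    and N: "distributed M lborel N g"
    and X: "\<And>\<omega>. \<omega> \<in> space M \<Longrightarrow> X \<omega> = S \<omega> + N \<omega>"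
    and P: "finite P"
    and q [measurable]: "q \<in> borel \<rightarrow>\<^sub>M count_space P"
    and T [measurable]: "T \<in> borel \<rightarrow>\<^sub>M C"
    and k [measurable]: "k \<in> borel_measurable borel"
    and e [measurable]: "(\<lambda>(s, y). e s y) \<in> borel_measurable (borel \<Otimes>\<^sub>M C)"
    and e_pos: "\<And>s y. 0 < e s y" and e_le: "\<And>s y. e s y \<le> 1"
    and factor: "AE s in distr M borel S. \<forall>x. g (x - s) = k x * e s (T x)"
  shows "mutual_information b (count_space P) borel (\<lambda>\<omega>. q (S \<omega>)) X =
    mutual_information b (count_space P) C (\<lambda>\<omega>. q (S \<omega>)) (\<lambda>\<omega>. T (X \<omega>))"
proof -
  have S [measurable]: "S \<in> borel_measurable M" and N' [measurable]: "N \<in> borel_measurable M"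
    using indep_var_rv1[OF indep] indep_var_rv2[OF indep] .
  have X' [measurable]: "X \<in> borel_measurable M"
    by (subst measurable_cong[OF X]) simp_all
  have g [measurable]: "g \<in> borel_measurable borel"
    using distributed_borel_measurable[OF N] by simp
  interpret PS: prob_space "distr M borel S" by (rule prob_space_distr) fact
  \<comment> \<open>Up to the factor \<open>k x\<close>, \<open>r G (T x)\<close> is the density at
    \<open>x\<close> of \<open>X\<close> on the event that \<open>S\<close> lies in
    \<open>G\<close>. In Bayes' quotient this factor cancels; \<open>\<rho>\<close> is defined with
    it already removed, so no division by a possibly vanishing \<open>k x\<close> occurs.\<close>
  define r where "r G y = (\<integral>\<^sup>+s. indicator G s * e s y \<partial>distr M borel S)" for G y
  define \<rho> where "\<rho> p y = enn2real (r (q -` {p}) y / r UNIV y)" for p y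
  have e_s [measurable]: "(\<lambda>s. e s y) \<in> borel_measurable borel" if "y \<in> space C" for y
    using measurable_compose[OF measurable_Pair2'[OF that] e] by simp
  have r_meas [measurable]: "r G \<in> borel_measurable C" if [measurable]: "G \<in> sets borel" for G
  proof -
    have "(\<lambda>(y, s). indicator G s * e s y) \<in> borel_measurable (C \<Otimes>\<^sub>M distr M borel S)"
      by (simp cong: measurable_cong_sets)
    from PS.borel_measurable_nn_integral[OF this] show ?thesis
      by (simp add: r_def[abs_def])
  qed
  have T_space: "T x \<in> space C" for x
    using measurable_space[OF T, of x] by simp
  have r_le: "r G y \<le> 1" for G y
  proof -
    have "r G y \<le> (\<integral>\<^sup>+s. 1 \<partial>distr M borel S)"
      unfolding r_def using e_le by (intro nn_integral_mono) (auto simp: indicator_def)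
    then show ?thesis using PS.emeasure_space_1 by simp
  qed
  have r_mono: "r G y \<le> r UNIV y" for G y
    unfolding r_def by (intro nn_integral_mono) (auto simp: indicator_def)
  \<comment> \<open>Positivity of \<open>e\<close> keeps the denominator of \<open>\<rho>\<close>
    away from 0, and the bound \<open>e s y \<le> 1\<close> keeps it finite. Hence the extended
    division in \<open>\<rho>\<close> can be undone by multiplication.\<close>
  have r_pos: "r UNIV (T x) > 0" for x
  proof (rule ccontr)
    assume "\<not> 0 < r UNIV (T x)"
    then have "(\<integral>\<^sup>+s. e s (T x) \<partial>distr M borel S) = 0"
      by (simp add: r_def)
    then have "AE s in distr M borel S. e s (T x) = 0"
      using T_space by (subst (asm) nn_integral_0_iff_AE) auto
    then have "AE s in distr M borel S. False"
      by eventually_elim (use e_pos[of _ "T x"] in \<open>auto simp: less_le\<close>)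
    then show False by simp
  qed
  have r_fin: "r G y < \<top>" for G y
    using r_le[of G y] by (simp add: le_less_trans)
  have \<rho>: "ennreal (\<rho> p (T x)) * r UNIV (T x) = r (q -` {p}) (T x)" for p x
  proof -
    have "r (q -` {p}) (T x) / r UNIV (T x) < \<top>"
      using r_pos[of x] r_fin[of "q -` {p}" "T x"] by (simp add: less_top[symmetric] ennreal_divide_eq_top_iff zero_less_iff_neq_zero)
    then have "ennreal (\<rho> p (T x)) = r (q -` {p}) (T x) / r UNIV (T x)"
      by (simp add: \<rho>_def)
    then show ?thesis
      using r_pos[of x] r_fin[of UNIV "T x"]
      by (simp add: ennreal_divide_times mult_divide_eq_ennreal)
  qed
  have joint: "emeasure M {\<omega> \<in> space M. S \<omega> \<in> G \<and> X \<omega> \<in> A} =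
      (\<integral>\<^sup>+x. indicator A x * (k x * r G (T x)) \<partial>lborel)"
    if [measurable]: "G \<in> sets borel" "A \<in> sets borel" for G A
  proof -
    have "(\<integral>\<^sup>+s. indicator G s * g (x - s) \<partial>distr M borel S) = k x * r G (T x)" for x
    proof -
      have "(\<integral>\<^sup>+s. indicator G s * g (x - s) \<partial>distr M borel S) =
          (\<integral>\<^sup>+s. k x * (indicator G s * e s (T x)) \<partial>distr M borel S)"
        by (rule nn_integral_cong_AE) (use factor in \<open>eventually_elim, simp add: mult_ac\<close>)
      also have "\<dots> = k x * r G (T x)"
        unfolding r_def using T_space by (intro nn_integral_cmult) simp
      finally show ?thesis .
    qed
    then show ?thesis
      by (subst emeasure_joint_additive_noise[OF indep N X]) simp_all
  qed
  have X_law: "distr M borel X = density lborel (\<lambda>x. k x * r UNIV (T x))"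
  proof (rule measure_eqI)
    fix A assume "A \<in> sets (distr M borel X)"
    then have A [measurable]: "A \<in> sets borel" by simp
    have "emeasure (distr M borel X) A = emeasure M {\<omega> \<in> space M. S \<omega> \<in> UNIV \<and> X \<omega> \<in> A}"
      by (subst emeasure_distr) (auto intro!: arg_cong[where f = "emeasure M"])
    also have "\<dots> = emeasure (density lborel (\<lambda>x. k x * r UNIV (T x))) A"
      by (subst joint) (simp_all add: emeasure_density mult_ac)
    finally show "emeasure (distr M borel X) A = emeasure (density lborel (\<lambda>x. k x * r UNIV (T x))) A" .
  qed simp
  show ?thesis
  proof (rule mutual_information_eq_if_posterior_factors[OF P _ X' T])
    show "(\<lambda>\<omega>. q (S \<omega>)) \<in> M \<rightarrow>\<^sub>M count_space P" by measurable
    have q_vimage [measurable]: "q -` {p} \<in> sets borel" if "p \<in> P" for p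
      using measurable_sets[OF q, of "{p}"] that by simp
    show "\<rho> p \<in> borel_measurable C" if "p \<in> P" for p
      unfolding \<rho>_def using that by measurable
    show "0 \<le> \<rho> p y" for p y by (simp add: \<rho>_def)
    show "emeasure M {\<omega> \<in> space M. q (S \<omega>) = p \<and> X \<omega> \<in> A} =
        (\<integral>\<^sup>+\<omega>. indicator A (X \<omega>) * ennreal (\<rho> p (T (X \<omega>))) \<partial>M)"
      if p: "p \<in> P" and A [measurable]: "A \<in> sets borel" for p A
    proof -
      have [measurable]: "\<rho> p \<in> borel_measurable C"
        unfolding \<rho>_def using p by measurable
      have "(\<integral>\<^sup>+\<omega>. indicator A (X \<omega>) * ennreal (\<rho> p (T (X \<omega>))) \<partial>M) =
          (\<integral>\<^sup>+x. indicator A x * ennreal (\<rho> p (T x)) \<partial>distr M borel X)"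
        by (subst nn_integral_distr) simp_all
      \<comment> \<open>The density of \<open>X\<close> contributes
        \<open>k x * r UNIV (T x)\<close>, whose second factor is exactly the denominator of the
        posterior.\<close>
      also have "\<dots> = (\<integral>\<^sup>+x. indicator A x * (k x * (ennreal (\<rho> p (T x)) * r UNIV (T x))) \<partial>lborel)"
        unfolding X_law by (subst nn_integral_density) (simp_all add: mult_ac)
      also have "\<dots> = emeasure M {\<omega> \<in> space M. S \<omega> \<in> q -` {p} \<and> X \<omega> \<in> A}"
        unfolding \<rho> using p by (subst joint) simp_all
      finally show ?thesis by simp
    qed
  qed
qed

section \<open>Vanishing of the eigenvalues beyond the rank\<close>

text \<open>If \<open>ev k\<close> were positive, so would be every earlier eigenvalue. The
  orthonormal eigenvectors at the indices up to \<open>k\<close> would then all lie in the range of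
  \<open>C\<close>, and there are more of them than its dimension allows.\<close>

lemma trailing_eigenvalue_eq_0:
  fixes C W :: "real^('n::{finite,linorder})^('n::{finite,linorder})"
    and ev :: "'n \<Rightarrow> real"
  assumes W: "orthogonal_matrix W" and ev: "antimono ev"
    and eig: "\<And>i. C *v column i W = ev i *\<^sub>R column i W"
    and nonneg: "\<And>i. 0 \<le> ev i" and rank: "rank C < card {..k}"
  shows "ev k = 0"
proof (rule ccontr)
  assume "ev k \<noteq> 0"
  with nonneg[of k] have pos: "0 < ev k" by simp
  let ?w = "\<lambda>i. column i W"
  have orth: "orthogonal (?w i) (?w j)" if "i \<noteq> j" for i j
    using W that by (simp add: orthogonal_matrix_orthonormal_columns)
  have nz: "?w i \<noteq> 0" for i
    using W by (metis norm_zero orthogonal_matrix_orthonormal_columns zero_neq_one)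
  have inj: "inj ?w"
    by (rule injI) (metis orth orthogonal_self nz)
  have "independent (?w ` {..k})"
    proof (rule pairwise_orthogonal_independent)
    show "pairwise orthogonal (?w ` {..k})"
      by (auto simp: pairwise_def intro!: orth)
    show "0 \<notin> ?w ` {..k}" using nz by (metis imageE)
  qed
  moreover have "?w ` {..k} \<subseteq> range ((*v) C)"
  proof safe
    fix i assume "i \<le> k"
    then have "ev i > 0" using pos antimonoD[OF ev] by (metis less_le_trans)
    then have "?w i = C *v (inverse (ev i) *\<^sub>R ?w i)"
      by (simp add: matrix_vector_mult_scaleR eig)
    then show "?w i \<in> range ((*v) C)" by blast
  qed
  ultimately have "card (?w ` {..k}) \<le> dim (range ((*v) C))"
    by (intro independent_card_le_dim)
  moreover have "card (?w ` {..k}) = card {..k}"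
    using inj by (intro card_image) (auto simp: inj_on_def)
  ultimately show False using rank by (simp add: rank_dim_range)
qed

section \<open>Moments of an isotropic Gaussian vector\<close>

text \<open>The reflection scales the coordinate along \<open>b\<close> by -1 and the others by 1,
  so its Jacobian has absolute value 1.\<close>

lemma lborel_distr_reflect:
  fixes b :: "'e::euclidean_space"
  assumes b: "b \<in> Basis"
  shows "distr lborel borel (\<lambda>x. x - (2 * (x \<bullet> b)) *\<^sub>R b) = lborel"
proof -
  let ?c = "\<lambda>j. if j = b then - 1 else 1 :: real"
  have "x - (2 * (x \<bullet> b)) *\<^sub>R b = 0 + (\<Sum>j\<in>Basis. (?c j * (x \<bullet> j)) *\<^sub>R j)" for x
  proof (rule euclidean_eqI)
    fix d :: 'e assume d: "d \<in> Basis"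
    have "(0 + (\<Sum>j\<in>Basis. (?c j * (x \<bullet> j)) *\<^sub>R j)) \<bullet> d = ?c d * (x \<bullet> d)"
      using inner_sum_left_Basis[OF d, of "\<lambda>j. ?c j * (x \<bullet> j)"] by simp
    also have "\<dots> = (x - (2 * (x \<bullet> b)) *\<^sub>R b) \<bullet> d"
      using b d by (simp add: inner_diff_left inner_Basis)
    finally show "(x - (2 * (x \<bullet> b)) *\<^sub>R b) \<bullet> d =
        (0 + (\<Sum>j\<in>Basis. (?c j * (x \<bullet> j)) *\<^sub>R j)) \<bullet> d" ..
  qed
  moreover have "(\<Prod>j\<in>Basis. \<bar>?c j\<bar>) = 1"
    by (rule prod.neutral) simp
  ultimately show ?thesis
    using lborel_affine_euclidean[of ?c 0] by (simp add: density_1 del: add_0 add_0_left)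
qed

lemma norm_reflect:
  fixes b :: "'e::euclidean_space"
  assumes "b \<in> Basis"
  shows "norm (x - (2 * (x \<bullet> b)) *\<^sub>R b) = norm x"
  using assms by (simp add: norm_eq inner_diff_left inner_diff_right inner_commute[of b x])

text \<open>Lebesgue measure and a radial density are both invariant under the reflection, hence so
  is the law of \<open>N\<close>. An \<open>f\<close> that changes sign under the reflection
  therefore has expectation 0.\<close>

lemma (in prob_space) expectation_reflect:
  fixes N :: "'a \<Rightarrow> 'e::euclidean_space" and f :: "'e \<Rightarrow> real"
  assumes N: "distributed M lborel N (\<lambda>x. h (norm x))" and b: "b \<in> Basis"
    and f [measurable]: "f \<in> borel_measurable borel"
  shows "expectation (\<lambda>\<omega>. f (N \<omega> - (2 * (N \<omega> \<bullet> b)) *\<^sub>R b)) = expectation (\<lambda>\<omega>. f (N \<omega>))"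
proof -
  let ?R = "\<lambda>x. x - (2 * (x \<bullet> b)) *\<^sub>R b"
  have N' [measurable]: "N \<in> borel_measurable M"
    using distributed_measurable[OF N] by simp
  have h [measurable]: "(\<lambda>x::'e. h (norm x)) \<in> borel_measurable borel"
    using distributed_borel_measurable[OF N] by simp
  have law: "distr M borel N = density lborel (\<lambda>x. h (norm x))"
    using distributed_distr_eq_density[OF N] by (simp cong: distr_cong)
  have "density lborel (\<lambda>x. h (norm x)) = density (distr lborel borel ?R) (\<lambda>x. h (norm x))"
    unfolding lborel_distr_reflect[OF b] ..
  also have "\<dots> = distr (density lborel (\<lambda>x. h (norm x))) borel ?R"
    by (subst density_distr) (simp_all add: norm_reflect[OF b])
  finally have "distr M borel N = distr (distr M borel N) borel ?R"
    unfolding law .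
  also have "\<dots> = distr M borel (\<lambda>\<omega>. ?R (N \<omega>))"
    by (subst distr_distr) (simp_all add: comp_def)
  finally have eq: "distr M borel N = distr M borel (\<lambda>\<omega>. ?R (N \<omega>))" .
  have "expectation (\<lambda>\<omega>. f (?R (N \<omega>))) = (\<integral>x. f x \<partial>distr M borel (\<lambda>\<omega>. ?R (N \<omega>)))"
    by (subst integral_distr) simp_all
  also have "\<dots> = expectation (\<lambda>\<omega>. f (N \<omega>))"
    unfolding eq[symmetric] by (subst integral_distr) simp_all
  finally show ?thesis .
qed

lemma power2_norm_Basis: "(norm x)\<^sup>2 = (\<Sum>b\<in>Basis. (x \<bullet> b)\<^sup>2)"
  by (simp only: power2_norm_eq_inner) (simp add: euclidean_inner[of x x] power2_eq_square)

lemma integrable_gaussian_moment: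
  assumes "0 < s"
  shows "integrable lborel (\<lambda>y::real. y ^ k * exp (- y\<^sup>2 / (2 * s)))"
proof -
  have "integrable lborel (\<lambda>y. sqrt (2 * pi * s) * (normal_density 0 (sqrt s) y * (y - 0) ^ k))"
    by (intro integrable_mult_right integrable_normal_moment) (use assms in simp)
  then show ?thesis
    using assms by (simp add: normal_density_def mult_ac)
qed

text \<open>The integral for a second moment factors over the coordinates into one-dimensional
  integrals whose product is the same for every \<open>b\<close>; symmetry under reflections kills
  the rest. The value \<open>\<tau>\<close> is left open, since all that matters later is that the
  covariance matrix is some multiple of the identity.\<close>

lemma (in prob_space) isotropic_gaussian_moments:
  fixes N :: "'a \<Rightarrow> 'e::euclidean_space"
  assumes N: "distributed M lborel N (\<lambda>x. ennreal (c * exp (- (norm x)\<^sup>2 / (2 * s))))"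
    and s: "0 < s"
  obtains \<tau> where "\<And>b. b \<in> Basis \<Longrightarrow> integrable M (\<lambda>\<omega>. (N \<omega> \<bullet> b)\<^sup>2)"
    and "\<And>b. b \<in> Basis \<Longrightarrow> expectation (\<lambda>\<omega>. N \<omega> \<bullet> b) = 0"
    and "\<And>b d. b \<in> Basis \<Longrightarrow> d \<in> Basis \<Longrightarrow>
      expectation (\<lambda>\<omega>. (N \<omega> \<bullet> b) * (N \<omega> \<bullet> d)) = (if b = d then \<tau> else 0)"
proof -
  \<comment> \<open>Unnormalized one-dimensional moments: the distinguished coordinate contributes
    \<open>u 2\<close>, each of the other \<open>DIM('e) - 1\<close> contributes
    \<open>u 0\<close>.\<close>
  define u where "u k = (\<integral>\<^sup>+y. ennreal (y ^ k * exp (- y\<^sup>2 / (2 * s))) \<partial>lborel)" for k :: nat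
  define \<tau> where "\<tau> = enn2real (ennreal c * (u 2 * u 0 ^ (DIM('e) - 1)))"
  have u_fin: "u k < \<top>" for k
    using integrableD(2)[OF integrable_gaussian_moment[OF s, of k]]
    by (simp add: u_def less_top)
  have N' [measurable]: "N \<in> borel_measurable M"
    using distributed_measurable[OF N] by simp
  have second: "(\<integral>\<^sup>+\<omega>. ennreal ((N \<omega> \<bullet> b)\<^sup>2) \<partial>M) = ennreal c * (u 2 * u 0 ^ (DIM('e) - 1))"
    if b: "b \<in> Basis" for b
  proof -
    let ?f = "\<lambda>d y. ennreal ((if d = b then y\<^sup>2 else 1) * exp (- y\<^sup>2 / (2 * s)))"
    have "(\<integral>\<^sup>+\<omega>. ennreal ((N \<omega> \<bullet> b)\<^sup>2) \<partial>M) =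
        (\<integral>\<^sup>+x. ennreal (c * exp (- (norm x)\<^sup>2 / (2 * s))) * ennreal ((x \<bullet> b)\<^sup>2) \<partial>lborel)"
      by (rule distributed_nn_integral[OF N, symmetric]) simp
    also have "\<dots> = (\<integral>\<^sup>+x. ennreal c * (\<Prod>d\<in>Basis. ?f d (x \<bullet> d)) \<partial>lborel)"
    proof (rule nn_integral_cong)
      fix x :: 'e
      have "(\<Prod>d\<in>Basis. (if d = b then (x \<bullet> d)\<^sup>2 else 1) * exp (- (x \<bullet> d)\<^sup>2 / (2 * s))) =
          (x \<bullet> b)\<^sup>2 * exp (\<Sum>d\<in>Basis. - (x \<bullet> d)\<^sup>2 / (2 * s))"
        using b by (simp add: prod.distrib exp_sum prod.delta)
      also have "(\<Sum>d\<in>Basis. - (x \<bullet> d)\<^sup>2 / (2 * s)) = - (norm x)\<^sup>2 / (2 * s)"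
        by (simp add: power2_norm_Basis sum_divide_distrib sum_negf)
      finally have "(\<Prod>d\<in>Basis. ?f d (x \<bullet> d)) =
          ennreal ((x \<bullet> b)\<^sup>2 * exp (- (norm x)\<^sup>2 / (2 * s)))"
        by (subst prod_ennreal) simp_all
      then show "ennreal (c * exp (- (norm x)\<^sup>2 / (2 * s))) * ennreal ((x \<bullet> b)\<^sup>2) =
          ennreal c * (\<Prod>d\<in>Basis. ?f d (x \<bullet> d))"
        by (simp add: ennreal_mult'' mult_ac)
    qed
    also have "\<dots> = ennreal c * (\<Prod>d\<in>Basis. \<integral>\<^sup>+y. ?f d y \<partial>lborel)"
    proof (subst nn_integral_cmult)
      have "(\<integral>\<^sup>+x. (\<Prod>d\<in>Basis. ?f d (x \<bullet> d)) \<partial>lborel) = (\<Prod>d\<in>Basis. \<integral>\<^sup>+y. ?f d y \<partial>lborel)"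
        by (rule nn_integral_lborel_prod) simp_all
      then show "ennreal c * (\<integral>\<^sup>+x. (\<Prod>d\<in>Basis. ?f d (x \<bullet> d)) \<partial>lborel) =
          ennreal c * (\<Prod>d\<in>Basis. \<integral>\<^sup>+y. ?f d y \<partial>lborel)"
        by simp
    qed simp
    also have "(\<Prod>d\<in>Basis. \<integral>\<^sup>+y. ?f d y \<partial>lborel) = u 2 * u 0 ^ (DIM('e) - 1)"
      using b by (simp add: prod.remove[OF _ b] u_def)
    finally show ?thesis .
  qed
  have fin: "ennreal c * (u 2 * u 0 ^ (DIM('e) - 1)) < \<top>"
    using u_fin by (simp add: ennreal_mult_less_top power_less_top_ennreal)
  have int: "integrable M (\<lambda>\<omega>. (N \<omega> \<bullet> b)\<^sup>2)" if "b \<in> Basis" for b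
    by (rule integrableI_nonneg) (use second[OF that] fin in auto)
  have sq: "expectation (\<lambda>\<omega>. (N \<omega> \<bullet> b) * (N \<omega> \<bullet> b)) = \<tau>" if "b \<in> Basis" for b
    using second[OF that] by (simp add: integral_eq_nn_integral \<tau>_def flip: power2_eq_square)
  have mean: "expectation (\<lambda>\<omega>. N \<omega> \<bullet> b) = 0" if "b \<in> Basis" for b
    using expectation_reflect[where h = "\<lambda>t. ennreal (c * exp (- t\<^sup>2 / (2 * s)))", OF N that,
        of "\<lambda>x. x \<bullet> b"] that
    by (simp add: inner_diff_left)
  \<comment> \<open>Reflecting along \<open>b\<close> alone flips the sign of the product, as
    \<open>d\<close> is orthogonal to \<open>b\<close>.\<close>
  have cross: "expectation (\<lambda>\<omega>. (N \<omega> \<bullet> b) * (N \<omega> \<bullet> d)) = 0"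
    if "b \<in> Basis" "d \<in> Basis" "b \<noteq> d" for b d
    using expectation_reflect[where h = "\<lambda>t. ennreal (c * exp (- t\<^sup>2 / (2 * s)))", OF N that(1),
        of "\<lambda>x. (x \<bullet> b) * (x \<bullet> d)"] that
    by (simp add: inner_diff_left inner_Basis)
  show thesis
    by (rule that[of \<tau>]) (use int mean sq cross in auto)
qed

section \<open>Covariance matrices\<close>

lemma borel_measurable_vec_nth [measurable]: "(\<lambda>x::real^'n. x $ i) \<in> borel_measurable borel"
  by (intro borel_measurable_continuous_onI continuous_intros)

lemma integrable_component_mult:
  fixes X :: "'a \<Rightarrow> real^'n"
  assumes [measurable]: "X \<in> borel_measurable M" and "integrable M (\<lambda>\<omega>. (norm (X \<omega>))\<^sup>2)"
  shows "integrable M (\<lambda>\<omega>. X \<omega> $ i * X \<omega> $ j)"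
proof (rule Bochner_Integration.integrable_bound[OF assms(2)])
  show "AE \<omega> in M. norm (X \<omega> $ i * X \<omega> $ j) \<le> norm ((norm (X \<omega>))\<^sup>2)"
    by (intro AE_I2) (simp add: abs_mult power2_eq_square mult_mono component_le_norm_cart)
qed measurable

lemma (in prob_space) integrable_component:
  fixes X :: "'a \<Rightarrow> real^'n"
  assumes [measurable]: "X \<in> borel_measurable M" and "integrable M (\<lambda>\<omega>. (norm (X \<omega>))\<^sup>2)"
  shows "integrable M (\<lambda>\<omega>. X \<omega> $ i)"
proof (rule square_integrable_imp_integrable)
  show "integrable M (\<lambda>\<omega>. (X \<omega> $ i)\<^sup>2)"
    unfolding power2_eq_square by (rule integrable_component_mult[OF assms])
qed measurable

text \<open>For a unit eigenvector \<open>w\<close> the left side is its eigenvalue. So eigenvalues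
  are variances of projections: they are nonnegative, and a zero eigenvalue makes the projection
  almost surely constant.\<close>

lemma (in prob_space) quadratic_form_covariance_matrix:
  fixes X :: "'a \<Rightarrow> real^'n"
  assumes X [measurable]: "X \<in> borel_measurable M" and X2: "integrable M (\<lambda>\<omega>. (norm (X \<omega>))\<^sup>2)"
  defines "\<mu> \<equiv> \<chi> i. expectation (\<lambda>\<omega>. X \<omega> $ i)"
  shows "w \<bullet> (covariance_matrix M X *v w) = expectation (\<lambda>\<omega>. (w \<bullet> (X \<omega> - \<mu>))\<^sup>2)"
    and "integrable M (\<lambda>\<omega>. (w \<bullet> (X \<omega> - \<mu>))\<^sup>2)"
proof -
  note int [simp] = integrable_component[OF X X2] integrable_component_mult[OF X X2]
  have prod: "integrable M (\<lambda>\<omega>. (X \<omega> $ i - \<mu> $ i) * (X \<omega> $ j - \<mu> $ j))" for i j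
    by (simp add: algebra_simps)
  have sq: "(w \<bullet> (X \<omega> - \<mu>))\<^sup>2 =
      (\<Sum>i\<in>UNIV. \<Sum>j\<in>UNIV. (w $ i * w $ j) * ((X \<omega> $ i - \<mu> $ i) * (X \<omega> $ j - \<mu> $ j)))" for \<omega>
    by (simp add: inner_vec_def power2_eq_square sum_product mult_ac)
  show "integrable M (\<lambda>\<omega>. (w \<bullet> (X \<omega> - \<mu>))\<^sup>2)"
    unfolding sq by (intro Bochner_Integration.integrable_sum integrable_mult_right prod)
  show "w \<bullet> (covariance_matrix M X *v w) = expectation (\<lambda>\<omega>. (w \<bullet> (X \<omega> - \<mu>))\<^sup>2)"
  proof -
    have sum: "expectation (\<lambda>\<omega>. \<Sum>i\<in>UNIV. \<Sum>j\<in>UNIV. F i j \<omega>) = (\<Sum>i\<in>UNIV. \<Sum>j\<in>UNIV. expectation (F i j))"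
      if "\<And>i j. integrable M (F i j)" for F :: "'n \<Rightarrow> 'n \<Rightarrow> 'a \<Rightarrow> real"
      using that by simp
    have "expectation (\<lambda>\<omega>. (w \<bullet> (X \<omega> - \<mu>))\<^sup>2) =
        (\<Sum>i\<in>UNIV. \<Sum>j\<in>UNIV. (w $ i * w $ j) * covariance_matrix M X $ i $ j)"
      unfolding sq by (subst sum, intro integrable_mult_right prod) (simp add: covariance_matrix_def \<mu>_def)
    also have "\<dots> = w \<bullet> (covariance_matrix M X *v w)"
      by (simp add: inner_vec_def matrix_vector_mult_def sum_distrib_left mult_ac)
    finally show ?thesis ..
  qed
qed

text \<open>After centring, each cross term is a product of independent factors with mean 0.
  Independence also yields its integrability.\<close>

lemma (in prob_space) covariance_matrix_add_indep:
  fixes S N X :: "'a \<Rightarrow> real^'n"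
  assumes indep: "indep_var borel S borel N"
    and S2: "integrable M (\<lambda>\<omega>. (norm (S \<omega>))\<^sup>2)" and N2: "integrable M (\<lambda>\<omega>. (norm (N \<omega>))\<^sup>2)"
    and X: "\<And>\<omega>. \<omega> \<in> space M \<Longrightarrow> X \<omega> = S \<omega> + N \<omega>"
  shows "covariance_matrix M X = covariance_matrix M S + covariance_matrix M N"
proof -
  have S [measurable]: "S \<in> borel_measurable M" and N [measurable]: "N \<in> borel_measurable M"
    using indep_var_rv1[OF indep] indep_var_rv2[OF indep] .
  note int [simp] = integrable_component[OF S S2] integrable_component_mult[OF S S2]
    integrable_component[OF N N2] integrable_component_mult[OF N N2]
  define \<mu> where "\<mu> i = expectation (\<lambda>\<omega>. S \<omega> $ i)" for i
  define \<nu> where "\<nu> i = expectation (\<lambda>\<omega>. N \<omega> $ i)" for i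
  have mean: "expectation (\<lambda>\<omega>. X \<omega> $ i) = \<mu> i + \<nu> i" for i
  proof -
    have "expectation (\<lambda>\<omega>. X \<omega> $ i) = expectation (\<lambda>\<omega>. S \<omega> $ i + N \<omega> $ i)"
      by (rule Bochner_Integration.integral_cong) (simp_all add: X)
    then show ?thesis by (simp add: \<mu>_def \<nu>_def)
  qed
  have cross_indep: "indep_var borel (\<lambda>\<omega>. S \<omega> $ i - \<mu> i) borel (\<lambda>\<omega>. N \<omega> $ j - \<nu> j)" for i j
    using indep_var_compose[OF indep, of "\<lambda>x. x $ i - \<mu> i" borel "\<lambda>x. x $ j - \<nu> j" borel]
    by (simp add: comp_def)
  have cross_int: "integrable M (\<lambda>\<omega>. (S \<omega> $ i - \<mu> i) * (N \<omega> $ j - \<nu> j))" for i j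
    by (rule indep_var_integrable[OF cross_indep]) simp_all
  have cross: "expectation (\<lambda>\<omega>. (S \<omega> $ i - \<mu> i) * (N \<omega> $ j - \<nu> j)) = 0" for i j
    by (subst indep_var_lebesgue_integral[OF cross_indep]) (simp_all add: \<mu>_def prob_space)
  have S_int: "integrable M (\<lambda>\<omega>. (S \<omega> $ i - \<mu> i) * (S \<omega> $ j - \<mu> j))"
    and N_int: "integrable M (\<lambda>\<omega>. (N \<omega> $ i - \<nu> i) * (N \<omega> $ j - \<nu> j))" for i j
    by (simp_all add: algebra_simps)
  have alg: "(a + b - (m + n)) * (c + d - (p + q)) =
      ((a - m) * (c - p) + (b - n) * (d - q)) + ((a - m) * (d - q) + (c - p) * (b - n))"
    for a b c d m n p q :: real
    by (simp add: algebra_simps)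
  have "expectation (\<lambda>\<omega>. (X \<omega> $ i - (\<mu> i + \<nu> i)) * (X \<omega> $ j - (\<mu> j + \<nu> j))) =
      expectation (\<lambda>\<omega>. (S \<omega> $ i - \<mu> i) * (S \<omega> $ j - \<mu> j)) +
      expectation (\<lambda>\<omega>. (N \<omega> $ i - \<nu> i) * (N \<omega> $ j - \<nu> j))" for i j
  proof -
    have "expectation (\<lambda>\<omega>. (X \<omega> $ i - (\<mu> i + \<nu> i)) * (X \<omega> $ j - (\<mu> j + \<nu> j))) =
      expectation (\<lambda>\<omega>. ((S \<omega> $ i - \<mu> i) * (S \<omega> $ j - \<mu> j) + (N \<omega> $ i - \<nu> i) * (N \<omega> $ j - \<nu> j)) +
        ((S \<omega> $ i - \<mu> i) * (N \<omega> $ j - \<nu> j) + (S \<omega> $ j - \<mu> j) * (N \<omega> $ i - \<nu> i)))"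
      by (rule Bochner_Integration.integral_cong[OF refl]) (simp only: X vector_add_component alg)
    also have "\<dots> = expectation (\<lambda>\<omega>. (S \<omega> $ i - \<mu> i) * (S \<omega> $ j - \<mu> j)) +
      expectation (\<lambda>\<omega>. (N \<omega> $ i - \<nu> i) * (N \<omega> $ j - \<nu> j))"
      by (subst Bochner_Integration.integral_add,
          (intro Bochner_Integration.integrable_add S_int N_int cross_int)+)
        (simp add: Bochner_Integration.integral_add[OF S_int N_int]
          Bochner_Integration.integral_add[OF cross_int cross_int] cross)
    finally show ?thesis .
  qed
  then show ?thesis
    by (simp add: covariance_matrix_def vec_eq_iff mean flip: \<mu>_def \<nu>_def)
qed

section \<open>Density of isotropic Gaussian noise\<close>

lemma mat_vector_mult: "(mat c :: real^'n^'n) *v v = c *\<^sub>R v"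
  by (simp add: vec_eq_iff matrix_vector_mult_def mat_def if_distrib[where f = "\<lambda>a. a * _"] cong: if_cong)

text \<open>Brings the density into the form of a constant times a radial exponential. The
  determinant stays unevaluated in the constant, as only this form is used.\<close>

lemma gaussian_density_isotropic:
  fixes x :: "real^'n"
  assumes "s \<noteq> 0"
  shows "gaussian_density 0 (mat s) x =
    inverse (sqrt ((2 * pi) ^ CARD('n) * det (mat s :: real^'n^'n))) * exp (- (norm x)\<^sup>2 / (2 * s))"
proof -
  have "invertible (mat s :: real^'n^'n)"
    unfolding invertible_def using assms
    by (intro exI[of _ "mat (inverse s)"]) (simp add: matrix_eq mat_vector_mult flip: matrix_vector_mul_assoc)
  \<comment> \<open>\<open>matrix_inv\<close> chooses some two-sided inverse; the explicit
    \<open>mat (inverse s)\<close> shows that one exists.\<close>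
  then have "mat s ** matrix_inv (mat s :: real^'n^'n) = mat 1"
    unfolding invertible_def matrix_inv_def by (rule someI2_ex) simp
  then have "s *\<^sub>R (matrix_inv (mat s) *v x) = x"
    by (metis matrix_vector_mul_assoc matrix_vector_mul_lid mat_vector_mult)
  then have "matrix_inv (mat s) *v x = inverse s *\<^sub>R x"
    using assms by (metis scaleR_scaleR left_inverse scaleR_one)
  then show ?thesis
    by (simp add: gaussian_density_def power2_norm_eq_inner divide_simps)
qed

section \<open>Indices of the retained components\<close>

text \<open>Isolates the index map inside \<open>first_components\<close>, so that the complement of
  its range can stand for the discarded axes.\<close>

definition first_index :: "'m::{finite,linorder} \<Rightarrow> 'n::{finite,linorder}" where
  "first_index i = sorted_list_of_set (UNIV :: 'n set) ! card {..<i}"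

lemma first_components_nth: "first_components y $ i = y $ first_index i"
  by (simp add: first_components_def first_index_def)

text \<open>The number of predecessors is strictly increasing, hence injective; equal finite
  cardinalities give surjectivity.\<close>

lemma bij_betw_card_lessThan:
  "bij_betw (\<lambda>i::'m::{finite,linorder}. card {..<i}) UNIV {..<CARD('m)}"
proof -
  have "strict_mono (\<lambda>i::'m. card {..<i})"
    by (intro strict_monoI psubset_card_mono) auto
  then have inj: "inj (\<lambda>i::'m. card {..<i})"
    by (rule strict_mono_imp_inj_on)
  have "range (\<lambda>i::'m. card {..<i}) \<subseteq> {..<CARD('m)}"
    by (auto intro!: psubset_card_mono)
  then have "range (\<lambda>i::'m. card {..<i}) = {..<CARD('m)}"
    using inj by (intro card_subset_eq) (simp_all add: card_image)
  with inj show ?thesis by (simp add: bij_betw_def)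
qed

lemma inj_first_index:
  assumes "CARD('m::{finite,linorder}) \<le> CARD('n::{finite,linorder})"
  shows "inj (first_index :: 'm \<Rightarrow> 'n)"
proof (rule injI)
  fix i j :: 'm
  assume "first_index i = (first_index j :: 'n)"
  moreover have "card {..<i} < CARD('n)" "card {..<j} < CARD('n)"
    using bij_betw_apply[OF bij_betw_card_lessThan, of i] bij_betw_apply[OF bij_betw_card_lessThan, of j] assms
    by simp_all
  ultimately have "card {..<i} = card {..<j}"
    unfolding first_index_def by (subst (asm) nth_eq_iff_index_eq) simp_all
  then show "i = j"
    using bij_betw_imp_inj_on[OF bij_betw_card_lessThan] by (auto dest: injD)
qed

text \<open>Positions in the sorted list count from 0, so an index missed by
  \<open>first_index\<close> sits at a position \<open>p \<ge> CARD('m)\<close> and has at least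
  \<open>p + 1\<close> indices up to and including itself. The strict inequality is what lets a rank
  of exactly \<open>CARD('m)\<close> pass.\<close>

lemma card_atMost_not_first_index:
  fixes k :: "'n::{finite,linorder}"
  assumes "k \<notin> range (first_index :: 'm::{finite,linorder} \<Rightarrow> 'n)"
  shows "CARD('m) < card {..k}"
proof -
  let ?xs = "sorted_list_of_set (UNIV :: 'n set)"
  obtain p where p: "p < CARD('n)" "k = ?xs ! p"
    using in_set_conv_nth[of k ?xs] by auto
  have "CARD('m) \<le> p"
  proof (rule ccontr)
    assume "\<not> CARD('m) \<le> p"
    then have "p \<in> (\<lambda>i::'m. card {..<i}) ` UNIV"
      using bij_betw_imp_surj_on[OF bij_betw_card_lessThan] by auto
    then show False
      using assms p(2) by (auto simp: first_index_def)
  qed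
  moreover have "(!) ?xs ` {..p} \<subseteq> {..k}"
    using p by (auto intro!: sorted_nth_mono)
  then have "card ((!) ?xs ` {..p}) \<le> card {..k}"
    by (intro card_mono) simp_all
  moreover have "card ((!) ?xs ` {..p}) = Suc p"
    using p(1) by (subst card_image) (auto intro!: inj_on_nth)
  ultimately show ?thesis by simp
qed

section \<open>Parseval's identity in the principal axes\<close>

lemma power2_norm_vec: "(norm x)\<^sup>2 = (\<Sum>i\<in>UNIV. (x $ i)\<^sup>2)" for x :: "real^'n"
  by (simp only: power2_norm_eq_inner) (simp add: inner_vec_def power2_eq_square)

lemma norm_orthogonal_matrix_columns:
  fixes W :: "real^'n^'n"
  assumes "orthogonal_matrix W"
  shows "(norm x)\<^sup>2 = (\<Sum>k\<in>UNIV. (column k W \<bullet> x)\<^sup>2)"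
proof -
  have "orthogonal_transformation ((*v) (transpose W))"
    using assms by (simp add: orthogonal_transformation_matrix)
  then have "norm x = norm (transpose W *v x)"
    by (simp add: orthogonal_transformation)
  moreover have "(transpose W *v x) $ k = column k W \<bullet> x" for k
    by (simp add: matrix_vector_mult_def transpose_def column_def inner_vec_def)
  ultimately show ?thesis
    by (simp only: power2_norm_vec)
qed

section \<open>Sufficiency of the leading principal components\<close>

theorem corollary3:
  fixes M :: "'a measure" and b :: real
    and S Noise X Y :: "'a \<Rightarrow> real^('n::{finite,linorder})"
    and Y\<^sub>M :: "'a \<Rightarrow> real^('m::{finite,linorder})"
    and W :: "real^('n::{finite,linorder})^('n::{finite,linorder})" and \<sigma> :: real
  assumes "information_space M b"
    and "CARD('m) < CARD('n)"
    and "prob_space.indep_var M borel S borel Noise"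
    and "integrable M (\<lambda>\<omega>. (norm (S \<omega>))\<^sup>2)"
    and "rank (covariance_matrix M S) \<le> CARD('m)"
    and "\<sigma>\<^sup>2 > 0"
    and "gaussian_vector M Noise 0 (mat (\<sigma>\<^sup>2))"
    and "\<And>\<omega>. \<omega> \<in> space M \<Longrightarrow> X \<omega> = S \<omega> + Noise \<omega>"
    and "pca_matrix (covariance_matrix M X) W"
    and "\<And>\<omega>. \<omega> \<in> space M \<Longrightarrow> Y \<omega> = transpose W *v X \<omega>"
    and "\<And>\<omega>. \<omega> \<in> space M \<Longrightarrow> Y\<^sub>M \<omega> = first_components (Y \<omega>)"
  shows "relevant_information_loss M b borel borel borel S X Y\<^sub>M = 0"
proof -
  interpret information_space M b by fact
  note indep = assms(3) and S2 = assms(4) and X = assms(8)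
  have S [measurable]: "S \<in> borel_measurable M" and N [measurable]: "Noise \<in> borel_measurable M"
    using indep_var_rv1[OF indep] indep_var_rv2[OF indep] .
  define c where "c = inverse (sqrt ((2 * pi) ^ CARD('n) * det (mat (\<sigma>\<^sup>2) :: ((real, 'n) vec, 'n) vec)))"
  define g where "g x = ennreal (c * exp (- (norm x)\<^sup>2 / (2 * \<sigma>\<^sup>2)))" for x :: "(real, 'n) vec"
  have N_distr: "distributed M lborel Noise g"
    using assms(6,7) by (simp add: gaussian_vector_def gaussian_density_isotropic c_def g_def[abs_def])
  obtain \<tau> where N_sq: "\<And>b. b \<in> Basis \<Longrightarrow> integrable M (\<lambda>\<omega>. (Noise \<omega> \<bullet> b)\<^sup>2)"
    and N_mean: "\<And>b. b \<in> Basis \<Longrightarrow> expectation (\<lambda>\<omega>. Noise \<omega> \<bullet> b) = 0"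
    and N_cov: "\<And>b d. b \<in> Basis \<Longrightarrow> d \<in> Basis \<Longrightarrow>
      expectation (\<lambda>\<omega>. (Noise \<omega> \<bullet> b) * (Noise \<omega> \<bullet> d)) = (if b = d then \<tau> else 0)"
    using isotropic_gaussian_moments[OF N_distr[unfolded g_def[abs_def]] assms(6)] by blast
  have N2: "integrable M (\<lambda>\<omega>. (norm (Noise \<omega>))\<^sup>2)"
    by (simp add: power2_norm_Basis N_sq)
  have "covariance_matrix M Noise = mat \<tau>"
  proof -
    have "expectation (\<lambda>\<omega>. Noise \<omega> $ i) = 0" for i
      using N_mean[of "axis i 1"] by (simp add: inner_axis)
    moreover have "expectation (\<lambda>\<omega>. Noise \<omega> $ i * Noise \<omega> $ j) = (if i = j then \<tau> else 0)" for i j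
      using N_cov[of "axis i 1" "axis j 1"] by (simp add: inner_axis axis_eq_axis)
    ultimately show ?thesis
      by (simp add: covariance_matrix_def mat_def vec_eq_iff)
  qed
  then have C_X: "covariance_matrix M X = covariance_matrix M S + mat \<tau>"
    using covariance_matrix_add_indep[OF indep S2 N2 X] by simp
  obtain ev :: "'n \<Rightarrow> real" where W: "orthogonal_matrix W" and ev: "antimono ev"
    and eig_X: "\<And>i. covariance_matrix M X *v column i W = ev i *\<^sub>R column i W"
    using assms(9) by (auto simp: pca_matrix_def)
  \<comment> \<open>Subtracting \<open>mat \<tau>\<close> keeps the eigenvectors and shifts all
    eigenvalues equally, so their order is preserved.\<close>
  have eig: "covariance_matrix M S *v column i W = (ev i - \<tau>) *\<^sub>R column i W" for i
  proof -
    show ?thesis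
      using eig_X[of i] by (simp add: C_X mat_vector_mult matrix_vector_mult_add_rdistrib algebra_simps)
  qed
  define \<mu> where "\<mu> = (\<chi> i. expectation (\<lambda>\<omega>. S \<omega> $ i))"
  note quad = quadratic_form_covariance_matrix[OF S S2, folded \<mu>_def]
  have unit: "column i W \<bullet> column i W = 1" for i
    using W by (simp add: orthogonal_matrix_orthonormal_columns norm_eq_1)
  have var: "ev i - \<tau> = expectation (\<lambda>\<omega>. (column i W \<bullet> (S \<omega> - \<mu>))\<^sup>2)" for i
    using quad(1)[of "column i W"] by (simp add: eig unit)
  define L where "L = range (first_index :: 'm \<Rightarrow> 'n)"
  have trailing: "AE \<omega> in M. column k W \<bullet> (S \<omega> - \<mu>) = 0" if "k \<notin> L" for k
  proof -
    have "ev k - \<tau> = 0"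
    proof (rule trailing_eigenvalue_eq_0[OF W _ eig])
      show "antimono (\<lambda>i. ev i - \<tau>)"
        using ev by (auto simp: antimono_def)
      show "0 \<le> ev i - \<tau>" for i unfolding var by simp
      show "rank (covariance_matrix M S) < card {..k}"
        using card_atMost_not_first_index[of k] that assms(5) unfolding L_def by (metis le_less_trans)
    qed
    then have "expectation (\<lambda>\<omega>. (column k W \<bullet> (S \<omega> - \<mu>))\<^sup>2) = 0"
      using var[of k] by simp
    then show ?thesis
      by (subst (asm) integral_nonneg_eq_0_iff_AE[OF quad(2)]) simp_all
  qed
  define T where "T x = (first_components (transpose W *v x) :: (real, 'm) vec)" for x
  have T_nth: "T x $ i = column (first_index i) W \<bullet> x" for x i
    by (simp add: T_def first_components_nth matrix_vector_mult_def transpose_def column_def inner_vec_def)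
  have T [measurable]: "T \<in> borel_measurable borel"
  proof -
    have "T = (\<lambda>x. \<chi> i. column (first_index i) W \<bullet> x)"
      by (simp add: fun_eq_iff vec_eq_iff T_nth)
    then show ?thesis
      by (auto intro!: borel_measurable_continuous_onI continuous_intros)
  qed
  \<comment> \<open>\<open>e\<close> is the Gaussian factor in the retained coordinates,
    \<open>k\<close> the one in the discarded coordinates with \<open>s\<close> replaced by its
    mean. The constant \<open>c\<close> goes into \<open>k\<close> so that \<open>e\<close> stays
    between 0 and 1.\<close>
  define e where "e s y = ennreal (exp (- (norm (y - T s))\<^sup>2 / (2 * \<sigma>\<^sup>2)))" for s y
  define k where
    "k x = ennreal (c * exp (- (\<Sum>j\<in>-L. (column j W \<bullet> (x - \<mu>))\<^sup>2) / (2 * \<sigma>\<^sup>2)))" for x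
  have exp_split: "c * exp (- (u + v) / d) = (c * exp (- u / d)) * exp (- v / d)" for u v d
    by (simp add: mult.assoc mult_exp_exp add_divide_distrib diff_divide_distrib)
  have factor: "AE s in distr M borel S. \<forall>x. g (x - s) = k x * e s (T x)"
  proof -
    \<comment> \<open>There are finitely many discarded axes, so a single null set serves all of
      them, and it does not depend on \<open>x\<close>.\<close>
    have "AE \<omega> in M. \<forall>j\<in>-L. column j W \<bullet> (S \<omega> - \<mu>) = 0"
      using trailing by (subst AE_ball_countable) (auto intro: countable_finite)
    then have "AE s in distr M borel S. \<forall>j\<in>-L. column j W \<bullet> (s - \<mu>) = 0"
      by (subst AE_distr_iff) simp_all
    then show ?thesis
    proof eventually_elim
      fix s assume s: "\<forall>j\<in>-L. column j W \<bullet> (s - \<mu>) = 0"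
      show "\<forall>x. g (x - s) = k x * e s (T x)"
      proof
        fix x
        have "(norm (x - s))\<^sup>2 =
            (\<Sum>j\<in>-L. (column j W \<bullet> (x - s))\<^sup>2) + (\<Sum>j\<in>L. (column j W \<bullet> (x - s))\<^sup>2)"
          unfolding norm_orthogonal_matrix_columns[OF W]
          by (subst sum.union_disjoint[symmetric]) (auto intro!: sum.cong)
        \<comment> \<open>For such \<open>s\<close>, the projections of \<open>s\<close> and
          \<open>\<mu>\<close> on each discarded axis agree.\<close>
        also have "(\<Sum>j\<in>-L. (column j W \<bullet> (x - s))\<^sup>2) = (\<Sum>j\<in>-L. (column j W \<bullet> (x - \<mu>))\<^sup>2)"
          using s by (intro sum.cong) (auto simp: inner_diff_right)
        also have "(\<Sum>j\<in>L. (column j W \<bullet> (x - s))\<^sup>2) = (norm (T x - T s))\<^sup>2"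
          unfolding L_def using inj_first_index[where 'm='m and 'n='n] assms(2)
          by (subst sum.reindex)
            (simp_all add: power2_norm_vec T_nth inner_diff_right)
        finally have norm: "(norm (x - s))\<^sup>2 =
            (\<Sum>j\<in>-L. (column j W \<bullet> (x - \<mu>))\<^sup>2) + (norm (T x - T s))\<^sup>2" .
        show "g (x - s) = k x * e s (T x)"
          unfolding g_def k_def e_def norm exp_split by (rule ennreal_mult'') simp
      qed
    qed
  qed
  have equal: "mutual_information b (count_space P) borel (\<lambda>\<omega>. quantize P (S \<omega>)) X =
      mutual_information b (count_space P) borel (\<lambda>\<omega>. quantize P (S \<omega>)) Y\<^sub>M"
    if P: "finite P" "partition_on UNIV P" "P \<subseteq> sets borel" for P
  proof -
    have quantize: "quantize P s = A" if "A \<in> P" "s \<in> A" for s A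
      unfolding quantize_def using partition_onD2[OF P(2)] that
      by (intro the_equality) (auto simp: disjoint_def)
    have q: "quantize P \<in> borel \<rightarrow>\<^sub>M count_space P"
    proof (subst measurable_count_space_eq2[OF P(1)], safe)
      fix s
      obtain A where "A \<in> P" "s \<in> A" using partition_onD1[OF P(2)] by blast
      then show "quantize P s \<in> P" by (simp add: quantize)
    next
      fix A assume A: "A \<in> P"
      \<comment> \<open>The quantized value is the cell itself, so the preimage of the point
        \<open>A\<close> is the set \<open>A\<close>, measurable because
        \<open>P \<subseteq> sets borel\<close>.\<close>
      have "quantize P -` {A} = A"
      proof safe
        fix s
        obtain B where "B \<in> P" "s \<in> B" using partition_onD1[OF P(2)] by blast
        then show "s \<in> quantize P s" by (simp add: quantize)
      qed (simp add: quantize A)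
      then show "quantize P -` {A} \<inter> space borel \<in> sets borel"
        using A P(3) by auto
    qed
    have "mutual_information b (count_space P) borel (\<lambda>\<omega>. quantize P (S \<omega>)) X =
        mutual_information b (count_space P) borel (\<lambda>\<omega>. quantize P (S \<omega>)) (\<lambda>\<omega>. T (X \<omega>))"
    proof (rule mutual_information_additive_noise_sufficient[OF indep N_distr X P(1) q T _ _ _ _ factor])
      show "k \<in> borel_measurable borel" unfolding k_def by measurable
      show "(\<lambda>(s, y). e s y) \<in> borel_measurable (borel \<Otimes>\<^sub>M borel)" unfolding e_def by measurable
      show "0 < e s y" for s y by (simp add: e_def)
      show "e s y \<le> 1" for s y by (simp add: e_def)
    qed
    \<comment> \<open>The equation for \<open>Y\<^sub>M\<close> is known on \<open>space M\<close>
      only, which suffices because mutual information depends only on the image measures.\<close>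
    also have "\<dots> = mutual_information b (count_space P) borel (\<lambda>\<omega>. quantize P (S \<omega>)) Y\<^sub>M"
      unfolding mutual_information_def
      by (intro arg_cong2[where f = "KL_divergence b"] arg_cong2[where f = pair_measure] distr_cong)
        (simp_all add: T_def assms(10,11))
    finally show ?thesis .
  qed
  let ?\<P> = "{P. finite P \<and> partition_on (UNIV :: (real, 'n) vec set) P \<and> P \<subseteq> sets borel}"
  \<comment> \<open>The trivial partition matters: the supremum over an empty family of extended
    reals would be minus infinity rather than 0.\<close>
  have "{UNIV} \<in> ?\<P>"
    by (auto simp: partition_on_def)
  then have "?\<P> \<noteq> {}" by blast
  moreover have "relevant_information_loss M b borel borel borel S X Y\<^sub>M = (SUP P\<in>?\<P>. 0)"
    unfolding relevant_information_loss_def space_borel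
    by (rule SUP_cong[OF refl]) (simp add: equal zero_ereal_def)
  ultimately show ?thesis by simp
qed

end
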